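(* Let $B(z),C(z)$ be analytic at $z=0$ with $B(0)=C(0)=1$, and let $B\circ C(z)=B(C(z)-1)$ and $B\diamond C(z)=B(\log C(z))$. Then for all $n\in\mathbb{N}_0$ and $x\in\mathbb{R}$, \[ P_n(B\circ C;x)=\sum_{k=0}^{n}S_C(n,k)P_k(B;x),\qquad P_n(B\diamond C;x)=\sum_{k=0}^{n}s_C(n,k)P_k(B;x). \]
   Context: For $F$ analytic at $0$ with $F(0)=1$, $\log F(z)$ is the branch with $\log F(0)=0$ near $0$ and $(F(z))^x=\exp(x\log F(z))$. Potential polynomials: $\sum_{n\ge0}P_n(F;x)\frac{z^n}{n!}=(F(z))^x$. $F$-Stirling numbers: $\frac{(\log F(z))^k}{k!}=\sum_{n\ge k}s_F(n,k)\frac{z^n}{n!}$ and $\frac{(F(z)-1)^k}{k!}=\sum_{n\ge k}S_F(n,k)\frac{z^n}{n!}$. *)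

theory Defs
  imports "HOL-Complex_Analysis.Complex_Analysis"
begin

text \<open>
  The coefficients \<open>a\<^sub>n\<close> in \<open>f z = (\<Sum>n. a\<^sub>n * z ^ n / n!)\<close>, for \<open>f\<close> analytic at \<open>0\<close>
  (see \<open>egf_coeff_sums\<close> below).
\<close>

definition egf_coeff :: "(complex \<Rightarrow> complex) \<Rightarrow> nat \<Rightarrow> complex" where
  "egf_coeff f n = fact n * fps_nth (fps_expansion f 0) n"

text \<open>
  If \<open>F\<close> is analytic at \<open>0\<close> and \<open>F 0 = 1\<close>, then near \<open>0\<close> the values of \<open>F\<close> avoid the branch
  cut of the principal logarithm, so that \<open>Ln (F z)\<close> is the analytic branch of \<open>log F\<close>
  vanishing at \<open>0\<close>; \<open>log_of_is_branch\<close> and \<open>log_of_unique\<close> state this. Away from \<open>0\<close> the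
  values are irrelevant, as only germs at \<open>0\<close> are used.
\<close>

definition log_of :: "(complex \<Rightarrow> complex) \<Rightarrow> complex \<Rightarrow> complex" where
  "log_of F z = Ln (F z)"

definition pow_of :: "(complex \<Rightarrow> complex) \<Rightarrow> real \<Rightarrow> complex \<Rightarrow> complex" where
  "pow_of F x z = exp (of_real x * log_of F z)"

definition potential_poly :: "nat \<Rightarrow> (complex \<Rightarrow> complex) \<Rightarrow> real \<Rightarrow> complex" where
  "potential_poly n F x = egf_coeff (pow_of F x) n"

definition F_stirling1 :: "(complex \<Rightarrow> complex) \<Rightarrow> nat \<Rightarrow> nat \<Rightarrow> complex" where
  "F_stirling1 F n k = egf_coeff (\<lambda>z. log_of F z ^ k / fact k) n"

definition F_stirling2 :: "(complex \<Rightarrow> complex) \<Rightarrow> nat \<Rightarrow> nat \<Rightarrow> complex" where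
  "F_stirling2 F n k = egf_coeff (\<lambda>z. (F z - 1) ^ k / fact k) n"

definition comp_circ :: "(complex \<Rightarrow> complex) \<Rightarrow> (complex \<Rightarrow> complex) \<Rightarrow> complex \<Rightarrow> complex" where
  "comp_circ B C z = B (C z - 1)"

definition comp_diamond :: "(complex \<Rightarrow> complex) \<Rightarrow> (complex \<Rightarrow> complex) \<Rightarrow> complex \<Rightarrow> complex" where
  "comp_diamond B C z = B (log_of C z)"

lemma egf_coeff_sums:
  assumes "f analytic_on {0}"
  shows "\<forall>\<^sub>F z in nhds 0. (\<lambda>n. egf_coeff f n * z ^ n / fact n) sums f z"
proof -
  have "f has_fps_expansion fps_expansion f 0"
    using assms by (rule analytic_at_imp_has_fps_expansion_0)
  then have r: "fps_conv_radius (fps_expansion f 0) > 0"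
    and ev: "\<forall>\<^sub>F z in nhds 0. eval_fps (fps_expansion f 0) z = f z"
    by (auto simp: has_fps_expansion_def)
  have "\<forall>\<^sub>F z in nhds 0. z \<in> eball (0::complex) (fps_conv_radius (fps_expansion f 0))"
    using r by (intro eventually_nhds_in_open) (auto simp: zero_ereal_def)
  with ev show ?thesis
  proof eventually_elim
    case (elim z)
    then have "(\<lambda>n. fps_nth (fps_expansion f 0) n * z ^ n) sums f z"
      using sums_eval_fps[of z "fps_expansion f 0"] by simp
    then show ?case
      by (simp add: egf_coeff_def)
  qed
qed

lemma log_of_is_branch:
  assumes "F analytic_on {0}" "F 0 = 1"
  shows "log_of F analytic_on {0}" "log_of F 0 = 0" "\<forall>\<^sub>F z in nhds 0. exp (log_of F z) = F z"
proof -
  have "(\<lambda>z. Ln (F z)) analytic_on {0}"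
    using assms by (intro analytic_intros) auto
  then show "log_of F analytic_on {0}"
    by (simp add: log_of_def[abs_def])
  show "log_of F 0 = 0"
    using assms by (simp add: log_of_def)
  have "isCont F 0"
    using assms(1) by (rule analytic_at_imp_isCont)
  then have "\<forall>\<^sub>F z in nhds 0. F z \<noteq> 0"
    using assms(2) by (intro tendsto_imp_eventually_ne[where c = 1])
      (auto simp: continuous_at tendsto_nhds_iff)
  then show "\<forall>\<^sub>F z in nhds 0. exp (log_of F z) = F z"
    by eventually_elim (simp add: log_of_def)
qed

lemma log_of_unique:
  assumes "g analytic_on {0}" "g 0 = 0" "\<forall>\<^sub>F z in nhds 0. exp (g z) = F z"
  shows "\<forall>\<^sub>F z in nhds 0. g z = log_of F z"
proof -
  have "isCont g 0"
    using assms(1) by (rule analytic_at_imp_isCont)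
  then have "(g \<longlongrightarrow> 0) (nhds 0)"
    using assms(2) by (simp add: continuous_at tendsto_nhds_iff)
  then have "\<forall>\<^sub>F z in nhds 0. dist (g z) 0 < pi"
    by (rule tendstoD) simp
  with assms(3) show ?thesis
  proof eventually_elim
    case (elim z)
    then have "\<bar>Im (g z)\<bar> < pi"
      using abs_Im_le_cmod[of "g z"] by simp
    then have "Ln (exp (g z)) = g z"
      by (intro Ln_exp) auto
    with elim show ?case
      by (simp add: log_of_def)
  qed
qed

lemma potential_poly_sums:
  assumes "F analytic_on {0}" "F 0 = 1"
  shows "\<forall>\<^sub>F z in nhds 0. (\<lambda>n. potential_poly n F x * z ^ n / fact n) sums pow_of F x z"
proof -
  have "pow_of F x analytic_on {0}"
    unfolding pow_of_def[abs_def] using log_of_is_branch[OF assms] by (intro analytic_intros)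
  then show ?thesis
    unfolding potential_poly_def by (rule egf_coeff_sums)
qed

lemma egf_coeff_power_eq_0:
  assumes "g analytic_on {0}" "g 0 = 0" "n < k"
  shows "egf_coeff (\<lambda>z. g z ^ k / fact k) n = 0"
proof -
  define G where "G = fps_expansion g 0"
  have G: "g has_fps_expansion G"
    unfolding G_def using assms(1) by (rule analytic_at_imp_has_fps_expansion_0)
  have "fps_nth G 0 = 0"
    by (simp add: G_def fps_expansion_def assms(2))
  then have "fps_nth (G ^ k) n = 0"
    using assms(3) by (simp add: startsby_zero_power_prefix)
  have "(\<lambda>z. (1 / fact k) * g z ^ k) has_fps_expansion fps_const (1 / fact k) * G ^ k"
    using G by (intro fps_expansion_intros)
  then have e: "(\<lambda>z. g z ^ k / fact k) has_fps_expansion fps_const (1 / fact k) * G ^ k"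
    by simp
  have "(\<lambda>z. g z ^ k / fact k) analytic_on {0}"
    using assms(1) by (intro analytic_intros) auto
  then have "(\<lambda>z. g z ^ k / fact k) has_fps_expansion fps_expansion (\<lambda>z. g z ^ k / fact k) 0"
    by (rule analytic_at_imp_has_fps_expansion_0)
  with e have "fps_expansion (\<lambda>z. g z ^ k / fact k) 0 = fps_const (1 / fact k) * G ^ k"
    using fps_expansion_unique_complex by blast
  with \<open>fps_nth (G ^ k) n = 0\<close> show ?thesis
    by (simp add: egf_coeff_def)
qed

lemma egf_coeff_power_sums:
  assumes "g analytic_on {0}" "g 0 = 0"
  shows "\<forall>\<^sub>F z in nhds 0. (\<lambda>n. egf_coeff (\<lambda>z. g z ^ k / fact k) (n + k) * z ^ (n + k) / fact (n + k))
           sums (g z ^ k / fact k)"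
proof -
  have "(\<lambda>z. g z ^ k / fact k) analytic_on {0}"
    using assms(1) by (intro analytic_intros) auto
  from egf_coeff_sums[OF this] show ?thesis
  proof eventually_elim
    case (elim z)
    show ?case
      using elim egf_coeff_power_eq_0[OF assms, of _ k]
      by (subst sums_zero_iff_shift) auto
  qed
qed

lemma F_stirling1_sums:
  assumes "F analytic_on {0}" "F 0 = 1"
  shows "\<forall>\<^sub>F z in nhds 0. (\<lambda>n. F_stirling1 F (n + k) k * z ^ (n + k) / fact (n + k))
           sums (log_of F z ^ k / fact k)"
  unfolding F_stirling1_def using log_of_is_branch[OF assms] by (intro egf_coeff_power_sums)

lemma F_stirling2_sums:
  assumes "F analytic_on {0}" "F 0 = 1"
  shows "\<forall>\<^sub>F z in nhds 0. (\<lambda>n. F_stirling2 F (n + k) k * z ^ (n + k) / fact (n + k))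
           sums ((F z - 1) ^ k / fact k)"
  unfolding F_stirling2_def using assms by (intro egf_coeff_power_sums analytic_intros) auto

end

theory Submission
  imports Defs
begin

text \<open>
  Pointwise \<open>(B \<circ> C)\<^sup>x = B\<^sup>x \<circ> (C - 1)\<close> and \<open>(B \<diamond> C)\<^sup>x = B\<^sup>x \<circ> log C\<close>, and both inner functions
  vanish at \<open>0\<close>. Hence both identities are instances of the composition rule for exponential
  generating functions \<open>f \<circ> g = (\<Sum>k. a\<^sub>k * g ^ k / k!)\<close>.
\<close>

text \<open>An analytic germ has only one power series expansion, so coefficients can be read off
  any series \<open>A\<close> built by the expansion calculus.\<close>

lemma egf_coeff_eqI:
  assumes "f has_fps_expansion A"
  shows "egf_coeff f n = fact n * fps_nth A n"
proof -
  have "f has_fps_expansion fps_expansion f 0"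
    using assms has_fps_expansion_imp_analytic_0 analytic_at_imp_has_fps_expansion_0 by blast
  with assms have "fps_expansion f 0 = A"
    using fps_expansion_unique_complex by blast
  then show ?thesis
    by (simp add: egf_coeff_def)
qed

text \<open>As \<open>g\<close> vanishes at 0, the k-th power of its series starts at order k or
  later, so only the terms with k \<le> n reach the n-th coefficient of the composite.\<close>

lemma egf_coeff_compose:
  assumes "f analytic_on {0}" "g analytic_on {0}" "g 0 = 0"
  shows "egf_coeff (\<lambda>z. f (g z)) n =
           (\<Sum>k=0..n. egf_coeff (\<lambda>z. g z ^ k / fact k) n * egf_coeff f k)"
proof -
  define A G where "A = fps_expansion f 0" and "G = fps_expansion g 0"
  have A: "f has_fps_expansion A" and G: "g has_fps_expansion G"
    unfolding A_def G_def using assms by (simp_all add: analytic_at_imp_has_fps_expansion_0)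
  have G0: "fps_nth G 0 = 0"
    by (simp add: G_def fps_expansion_def assms(3))
  have power: "egf_coeff (\<lambda>z. g z ^ k / fact k) n = fact n * (fps_nth (G ^ k) n / fact k)" for k
  proof -
    have "(\<lambda>z. (1 / fact k) * g z ^ k) has_fps_expansion fps_const (1 / fact k) * G ^ k"
      using G by (intro fps_expansion_intros)
    from egf_coeff_eqI[OF this] show ?thesis
      by simp
  qed
  have "(f \<circ> g) has_fps_expansion fps_compose A G"
    using A G G0 by (rule has_fps_expansion_compose)
  from egf_coeff_eqI[OF this]
  have "egf_coeff (\<lambda>z. f (g z)) n = fact n * (\<Sum>k=0..n. fps_nth A k * fps_nth (G ^ k) n)"
    by (simp add: o_def fps_compose_nth)
  \<comment> \<open>The \<open>fact k\<close> in \<open>egf_coeff f k\<close> cancels the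
    \<open>1 / fact k\<close> from \<open>power\<close>.\<close>
  then show ?thesis
    by (simp add: power egf_coeff_eqI[OF A] sum_distrib_left mult_ac)
qed

lemma pow_of_analytic:
  assumes "F analytic_on {0}" "F 0 = 1"
  shows "pow_of F x analytic_on {0}"
  unfolding pow_of_def[abs_def] using log_of_is_branch[OF assms] by (intro analytic_intros)

theorem theorem10:
  fixes B C :: "complex \<Rightarrow> complex" and n :: nat and x :: real
  assumes "B analytic_on {0}" and "C analytic_on {0}"
    and "B 0 = 1" and "C 0 = 1"
  shows "potential_poly n (comp_circ B C) x
           = (\<Sum>k=0..n. F_stirling2 C n k * potential_poly k B x)
       \<and> potential_poly n (comp_diamond B C) x
           = (\<Sum>k=0..n. F_stirling1 C n k * potential_poly k B x)"
proof
  have B: "pow_of B x analytic_on {0}"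
    using assms(1,3) by (rule pow_of_analytic)
  have C: "(\<lambda>z. C z - 1) analytic_on {0}" "C 0 - 1 = 0"
    using assms(2,4) by (simp_all add: analytic_on_diff)
  \<comment> \<open>This is an equality of functions, not only of germs: \<open>log_of\<close>
    applies \<open>Ln\<close> to the value of its argument at each point, so it commutes with
    substitution.\<close>
  have "pow_of (comp_circ B C) x = (\<lambda>z. pow_of B x (C z - 1))"
    by (simp add: fun_eq_iff pow_of_def log_of_def comp_circ_def)
  then show "potential_poly n (comp_circ B C) x
      = (\<Sum>k=0..n. F_stirling2 C n k * potential_poly k B x)"
    unfolding potential_poly_def F_stirling2_def using egf_coeff_compose[OF B C] by simp
  have "pow_of (comp_diamond B C) x = (\<lambda>z. pow_of B x (log_of C z))"
    by (simp add: fun_eq_iff pow_of_def log_of_def comp_diamond_def)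
  then show "potential_poly n (comp_diamond B C) x
      = (\<Sum>k=0..n. F_stirling1 C n k * potential_poly k B x)"
    unfolding potential_poly_def F_stirling1_def
    using egf_coeff_compose[OF B log_of_is_branch(1,2)[OF assms(2,4)]] by simp
qed

end
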